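(* Assume $\alpha=\gamma$ and $\alpha+\beta>1$. Then a.a.s. for all vertices $u$ of $K(n,P)$ we have $|N(u)|=(1+o(1))(\alpha+\beta)^n$ and \[\left|\left\{w\in N(u):\ H(u,w)=(1+o(1))\tfrac{\beta}{\alpha+\beta}n\right\}\right|=(1+o(1))(\alpha+\beta)^n .\]
   Context: Let $0<\alpha,\beta,\gamma<1$ be constants not depending on $n$, and $P=\begin{pmatrix}\alpha&\beta\\ \beta&\gamma\end{pmatrix}$ indexed by $\{0,1\}$ ($P_{1,1}=\alpha$, $P_{0,1}=P_{1,0}=\beta$, $P_{0,0}=\gamma$). The stochastic Kronecker graph $K(n,P)$ has vertex set $\mathbb Z_2^n$; writing $u_k$ for the $k$-th digit of $u$, each pair $\{u,v\}$ is an edge with probability $p_{u,v}=\prod_{k=1}^n P_{u_k,v_k}$, independently of all other pairs. $N(u)$ is the neighborhood of $u$ in $K(n,P)$ and $H(u,w)$ is the Hamming distance between the strings $u,w$. A.a.s. means with probability tending to $1$ as $n\to\infty$; the second statement means that there is a function $\varepsilon(n)\to0$ such that a.a.s. for every $u$ the number of $w\in N(u)$ with $|H(u,w)-\frac{\beta}{\alpha+\beta}n|\le\varepsilon(n)n$ is $(1+o(1))(\alpha+\beta)^n$. *)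

theory Defs
  imports "HOL-Probability.Probability" "HOL-Library.Z2"
begin

definition kron_matrix :: "real \<Rightarrow> real \<Rightarrow> real \<Rightarrow> bit \<Rightarrow> bit \<Rightarrow> real" where
  "kron_matrix \<alpha> \<beta> \<gamma> a b =
     (if a = 1 \<and> b = 1 then \<alpha> else if a = 0 \<and> b = 0 then \<gamma> else \<beta>)"

definition kron_vertices :: "nat \<Rightarrow> bit list set" where
  "kron_vertices n = {u. length u = n}"

definition kron_pairs :: "nat \<Rightarrow> bit list set set" where
  "kron_pairs n = {{u, v} | u v. u \<in> kron_vertices n \<and> v \<in> kron_vertices n \<and> u \<noteq> v}"

definition kron_prob :: "(bit \<Rightarrow> bit \<Rightarrow> real) \<Rightarrow> bit list \<Rightarrow> bit list \<Rightarrow> real" where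
  "kron_prob P u v = (\<Prod>k<length u. P (u ! k) (v ! k))"

text \<open>
  The probability attached to an unordered pair. It is well defined only for symmetric \<open>P\<close>;
  see \<open>kron_edge_prob_doubleton\<close> below.
\<close>

definition kron_edge_prob :: "(bit \<Rightarrow> bit \<Rightarrow> real) \<Rightarrow> bit list set \<Rightarrow> real" where
  "kron_edge_prob P e = (THE p. \<exists>u v. e = {u, v} \<and> p = kron_prob P u v)"

text \<open>The graph \<open>K(n,P)\<close>, as the distribution of its edge set.\<close>

definition kronecker_graph :: "nat \<Rightarrow> (bit \<Rightarrow> bit \<Rightarrow> real) \<Rightarrow> bit list set set pmf" where
  "kronecker_graph n P =
     map_pmf (\<lambda>f. {e \<in> kron_pairs n. f e})
       (Pi_pmf (kron_pairs n) False (\<lambda>e. bernoulli_pmf (kron_edge_prob P e)))"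

definition neighborhood :: "'a set set \<Rightarrow> 'a \<Rightarrow> 'a set" where
  "neighborhood E u = {w. {u, w} \<in> E}"

definition hamming :: "'a list \<Rightarrow> 'a list \<Rightarrow> nat" where
  "hamming u w = card {k. k < length u \<and> u ! k \<noteq> w ! k}"

lemma kron_edge_prob_doubleton:
  assumes sym: "\<And>a b. P a b = P b a" and len: "length u = length v"
  shows "kron_edge_prob P {u, v} = kron_prob P u v"
proof -
  have "kron_prob P v u = kron_prob P u v"
    unfolding kron_prob_def len using sym by (intro prod.cong) auto
  then show ?thesis
    unfolding kron_edge_prob_def by (intro the_equality) (auto simp: doubleton_eq_iff)
qed

lemma kron_matrix_sym: "kron_matrix \<alpha> \<beta> \<gamma> a b = kron_matrix \<alpha> \<beta> \<gamma> b a"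
  by (auto simp: kron_matrix_def)

end

theory Submission
  imports Defs "HOL-Real_Asymp.Real_Asymp"
begin

text \<open>
  When \<open>\<alpha> = \<gamma>\<close>, the numbers \<open>p\<^bsub>u,w\<^esub> / (\<alpha> + \<beta>)\<^sup>n\<close> are the probability weights of a random \<open>w\<close> that
  differs from \<open>u\<close> in each digit independently with probability \<open>\<beta> / (\<alpha> + \<beta>)\<close>. So \<open>H(u,w)\<close> is
  binomial under these weights, and by Hoeffding's inequality almost all of the expected degree
  \<open>(\<alpha> + \<beta>)\<^sup>n - \<alpha>\<^sup>n\<close> of \<open>u\<close> comes from vertices at distance close to \<open>\<beta> n / (\<alpha> + \<beta>)\<close>. The
  numbers of neighbours are in turn sums of independent indicators. Their mean may be far smaller
  than the square root of the number \<open>2\<^sup>n\<close> of summands, so Hoeffding's inequality is useless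
  here, but a multiplicative Chernoff bound with relative deviation \<open>1 / n\<close> gives failure
  probability \<open>2 exp (- (\<alpha> + \<beta>)\<^sup>n / (4 n\<^sup>2))\<close>, which survives a union bound over the \<open>2\<^sup>n\<close> vertices
  because \<open>\<alpha> + \<beta> > 1\<close>.
\<close>

section \<open>A multiplicative Chernoff bound\<close>

lemma exp_le_quadratic:
  fixes x :: real
  assumes "x \<le> 1"
  shows "exp x \<le> 1 + x + x\<^sup>2"
proof (cases "0 \<le> x")
  case True
  then show ?thesis using assms by (rule exp_bound)
next
  case False
  define y where "y = - x"
  have "0 \<le> y" using False by (simp add: y_def)
  then have pos: "0 < 1 + y + y\<^sup>2 / 2" by (simp add: add_pos_nonneg)
  have "exp x = 1 / exp y" by (simp add: y_def exp_minus field_simps)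
  also have "\<dots> \<le> 1 / (1 + y + y\<^sup>2 / 2)"
    using exp_lower_Taylor_quadratic[OF \<open>0 \<le> y\<close>] pos by (intro divide_left_mono) auto
  also have "\<dots> \<le> 1 - y + y\<^sup>2"
  proof -
    have "1 \<le> 1 + y\<^sup>2 / 2 + y ^ 3 / 2 + y ^ 4 / 2" using \<open>0 \<le> y\<close> by simp
    also have "\<dots> = (1 - y + y\<^sup>2) * (1 + y + y\<^sup>2 / 2)"
      by (simp add: field_simps power2_eq_square power3_eq_cube power4_eq_xxxx)
    finally show ?thesis using pos by (simp add: divide_le_eq)
  qed
  finally show ?thesis by (simp add: y_def)
qed

locale Chernoff_ineq = indep_interval_bounded_random_variables M I X "\<lambda>_. 0" "\<lambda>_. 1"
  for M :: "'a measure" and I :: "'b set" and X +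
  fixes \<mu> :: real
  defines "\<mu> \<equiv> (\<Sum>i\<in>I. expectation (X i))"
begin

lemma integrable_exp:
  assumes "i \<in> I"
  shows "integrable M (\<lambda>x. exp (l * X i x))"
proof (rule integrable_const_bound)
  show "AE x in M. norm (exp (l * X i x)) \<le> exp \<bar>l\<bar>"
    using AE_in_interval[OF assms]
  proof eventually_elim
    case (elim x)
    then have "l * X i x \<le> \<bar>l\<bar> * 1" by (intro mult_mono) auto
    then show ?case by simp
  qed
qed (use assms in measurable)

lemma expectation_exp_le:
  assumes i: "i \<in> I" and l: "l \<le> 1"
  shows "expectation (\<lambda>x. exp (l * X i x)) \<le> exp ((l + l\<^sup>2) * expectation (X i))"
proof -
  have int: "integrable M (X i)"
    using interval_bounded_random_variable.integrable[OF bounded_random_variable[OF i]] .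
  have "expectation (\<lambda>x. exp (l * X i x)) \<le> expectation (\<lambda>x. 1 + (l + l\<^sup>2) * X i x)"
  proof (intro integral_mono_AE integrable_exp i)
    show "AE x in M. exp (l * X i x) \<le> 1 + (l + l\<^sup>2) * X i x"
      using AE_in_interval[OF i]
    proof eventually_elim
      case (elim x)
      then have "l * X i x \<le> 1" using l mult_right_mono[of l 1 "X i x"] by simp
      then have "exp (l * X i x) \<le> 1 + l * X i x + l\<^sup>2 * (X i x)\<^sup>2"
        using exp_le_quadratic[of "l * X i x"] by (simp add: power_mult_distrib)
      moreover have "l\<^sup>2 * (X i x)\<^sup>2 \<le> l\<^sup>2 * X i x"
        using elim by (intro mult_left_mono) (simp_all add: power2_eq_square mult_left_le)
      ultimately show ?case by (simp add: distrib_right)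
    qed
  qed (use int in simp)
  also have "\<dots> = 1 + (l + l\<^sup>2) * expectation (X i)"
    using int by (simp add: prob_space)
  also have "\<dots> \<le> exp ((l + l\<^sup>2) * expectation (X i))"
    by (rule exp_ge_add_one_self)
  finally show ?thesis .
qed

lemma
  shows integrable_exp_centred_sum: "integrable M (\<lambda>x. exp (l * ((\<Sum>i\<in>I. X i x) - \<mu>)))"
    and expectation_exp_centred_sum_le:
      "l \<le> 1 \<Longrightarrow> expectation (\<lambda>x. exp (l * ((\<Sum>i\<in>I. X i x) - \<mu>))) \<le> exp (l\<^sup>2 * \<mu>)"
proof -
  have prod: "exp (l * ((\<Sum>i\<in>I. X i x) - \<mu>)) = exp (- l * \<mu>) * (\<Prod>i\<in>I. exp (l * X i x))" for x
    by (simp add: exp_sum[OF fin, symmetric] exp_add[symmetric] sum_distrib_left algebra_simps)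
  have indep_exp: "indep_vars (\<lambda>_. borel) (\<lambda>i x. exp (l * X i x)) I"
    by (rule indep_vars_compose2[OF indep]) simp
  show "integrable M (\<lambda>x. exp (l * ((\<Sum>i\<in>I. X i x) - \<mu>)))"
    unfolding prod
    by (intro integrable_mult_right indep_vars_integrable fin indep_exp integrable_exp)
  assume "l \<le> 1"
  have "expectation (\<lambda>x. exp (l * ((\<Sum>i\<in>I. X i x) - \<mu>)))
      = exp (- l * \<mu>) * (\<Prod>i\<in>I. expectation (\<lambda>x. exp (l * X i x)))"
    unfolding prod
    by (simp add: indep_vars_lebesgue_integral[OF fin indep_exp integrable_exp])
  also have "\<dots> \<le> exp (- l * \<mu>) * (\<Prod>i\<in>I. exp ((l + l\<^sup>2) * expectation (X i)))"
    using \<open>l \<le> 1\<close> by (intro mult_left_mono prod_mono conjI expectation_exp_le) simp_all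
  also have "\<dots> = exp (- l * \<mu>) * exp ((l + l\<^sup>2) * \<mu>)"
    by (simp add: \<mu>_def exp_sum[OF fin] sum_distrib_left)
  also have "\<dots> = exp (l\<^sup>2 * \<mu>)"
    by (simp add: exp_add[symmetric] algebra_simps)
  finally show "expectation (\<lambda>x. exp (l * ((\<Sum>i\<in>I. X i x) - \<mu>))) \<le> exp (l\<^sup>2 * \<mu>)" .
qed

text \<open>The choice \<open>\<bar>l\<bar> = t / 2\<close> minimises the exponent \<open>l\<^sup>2 * m - \<bar>l\<bar> * t * m\<close>.\<close>

lemma Chernoff_ineq_tail:
  assumes m: "\<mu> \<le> m" and t: "t \<le> 2" and l: "\<bar>l\<bar> = t / 2"
  shows "prob {x \<in> space M. t\<^sup>2 / 2 * m \<le> l * ((\<Sum>i\<in>I. X i x) - \<mu>)} \<le> exp (- m * t\<^sup>2 / 4)"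
proof -
  have "l\<^sup>2 = \<bar>l\<bar>\<^sup>2" by simp
  then have square: "l\<^sup>2 = t\<^sup>2 / 4" by (simp only: l power_divide) simp
  have "prob {x \<in> space M. t\<^sup>2 / 2 * m \<le> l * ((\<Sum>i\<in>I. X i x) - \<mu>)}
      = prob {x \<in> space M. exp (t\<^sup>2 / 2 * m) \<le> exp (l * ((\<Sum>i\<in>I. X i x) - \<mu>))}"
    by simp
  also have "\<dots> \<le> expectation (\<lambda>x. exp (l * ((\<Sum>i\<in>I. X i x) - \<mu>))) / exp (t\<^sup>2 / 2 * m)"
    by (rule integral_Markov_inequality_measure[where A = "{}"])
       (simp_all add: integrable_exp_centred_sum)
  also have "\<dots> \<le> exp (l\<^sup>2 * \<mu>) / exp (t\<^sup>2 / 2 * m)"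
    using l t by (intro divide_right_mono expectation_exp_centred_sum_le) auto
  also have "\<dots> \<le> exp (l\<^sup>2 * m) / exp (t\<^sup>2 / 2 * m)"
    using m by (intro divide_right_mono) (auto intro: mult_left_mono)
  also have "\<dots> = exp (- m * t\<^sup>2 / 4)"
    by (simp add: square exp_diff[symmetric] field_simps)
  finally show ?thesis .
qed

theorem Chernoff_ineq_abs_ge:
  assumes m: "\<mu> \<le> m" and t: "0 \<le> t" "t \<le> 2"
  shows "prob {x \<in> space M. t * m \<le> \<bar>(\<Sum>i\<in>I. X i x) - \<mu>\<bar>} \<le> 2 * exp (- m * t\<^sup>2 / 4)"
proof -
  define tail where
    "tail l = {x \<in> space M. t\<^sup>2 / 2 * m \<le> l * ((\<Sum>i\<in>I. X i x) - \<mu>)}" for l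
  have events: "tail l \<in> events" for l
    unfolding tail_def by measurable
  have "{x \<in> space M. t * m \<le> \<bar>(\<Sum>i\<in>I. X i x) - \<mu>\<bar>} \<subseteq> tail (t / 2) \<union> tail (- t / 2)"
  proof
    fix x assume x: "x \<in> {x \<in> space M. t * m \<le> \<bar>(\<Sum>i\<in>I. X i x) - \<mu>\<bar>}"
    then have "t / 2 * (t * m) \<le> t / 2 * \<bar>(\<Sum>i\<in>I. X i x) - \<mu>\<bar>"
      using t by (intro mult_left_mono) auto
    then show "x \<in> tail (t / 2) \<union> tail (- t / 2)"
      using x by (auto simp: tail_def power2_eq_square algebra_simps abs_if split: if_splits)
  qed
  then have "prob {x \<in> space M. t * m \<le> \<bar>(\<Sum>i\<in>I. X i x) - \<mu>\<bar>}
      \<le> prob (tail (t / 2) \<union> tail (- t / 2))"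
    by (intro finite_measure_mono sets.Un events)
  also have "\<dots> \<le> prob (tail (t / 2)) + prob (tail (- t / 2))"
    by (intro measure_Un_le events)
  also have "\<dots> \<le> exp (- m * t\<^sup>2 / 4) + exp (- m * t\<^sup>2 / 4)"
    unfolding tail_def using t by (intro add_mono Chernoff_ineq_tail m) auto
  finally show ?thesis by simp
qed

end

lemma Pi_pmf_bernoulli_Chernoff:
  fixes p :: "'a \<Rightarrow> real"
  assumes A: "finite A" "F \<subseteq> A" and p: "\<And>e. e \<in> F \<Longrightarrow> 0 \<le> p e \<and> p e \<le> 1"
    and m: "sum p F \<le> m" and t: "0 \<le> t" "t \<le> 2"
  shows "measure_pmf.prob (Pi_pmf A False (\<lambda>e. bernoulli_pmf (p e)))
           {f. t * m \<le> \<bar>real (card {e \<in> F. f e}) - sum p F\<bar>} \<le> 2 * exp (- m * t\<^sup>2 / 4)"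
proof -
  let ?Q = "Pi_pmf A False (\<lambda>e. bernoulli_pmf (p e))"
  have F: "finite F" using A by (rule finite_subset[rotated])
  have mean: "measure_pmf.expectation ?Q (\<lambda>f. of_bool (f e)) = p e" if "e \<in> F" for e
  proof -
    have "measure_pmf.expectation ?Q (\<lambda>f. of_bool (f e) :: real)
        = measure_pmf.expectation (map_pmf (\<lambda>f. f e) ?Q) of_bool"
      by simp
    also have "map_pmf (\<lambda>f. f e) ?Q = bernoulli_pmf (p e)"
      using that A by (subst Pi_pmf_component) auto
    finally show ?thesis using p[OF that] by simp
  qed
  interpret Chernoff_ineq ?Q F "\<lambda>e f. of_bool (f e)" "sum p F"
  proof unfold_locales
    have "prob_space.indep_vars ?Q (\<lambda>_. count_space UNIV) (\<lambda>e f. f e) F"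
      using measure_pmf.prob_space_axioms indep_vars_Pi_pmf[OF A(1)] A(2)
      by (rule prob_space.indep_vars_subset)
    then show "prob_space.indep_vars ?Q (\<lambda>_. borel) (\<lambda>e f. of_bool (f e) :: real) F"
      by (rule prob_space.indep_vars_compose2[OF measure_pmf.prob_space_axioms]) simp
  qed (simp_all add: F mean)
  have "(\<Sum>e\<in>F. of_bool (f e)) = real (card {e \<in> F. f e})" for f
    using F by (simp add: Int_def)
  then show ?thesis
    using Chernoff_ineq_abs_ge[OF m t] by simp
qed

section \<open>Events of high probability\<close>

lemma (in prob_space) prob_Ball_ge:
  assumes "finite I" and events: "\<And>i. i \<in> I \<Longrightarrow> {x \<in> space M. Q i x} \<in> events"
    and le: "\<And>i. i \<in> I \<Longrightarrow> prob {x \<in> space M. \<not> Q i x} \<le> b"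
  shows "1 - real (card I) * b \<le> prob {x \<in> space M. \<forall>i\<in>I. Q i x}"
proof -
  have "1 - prob {x \<in> space M. \<forall>i\<in>I. Q i x} = prob {x \<in> space M. \<not> (\<forall>i\<in>I. Q i x)}"
    using assms by (intro prob_neg[symmetric] sets.sets_Collect_finite_All) auto
  also have "{x \<in> space M. \<not> (\<forall>i\<in>I. Q i x)} = (\<Union>i\<in>I. {x \<in> space M. \<not> Q i x})"
    by auto
  also have "prob \<dots> \<le> (\<Sum>i\<in>I. prob {x \<in> space M. \<not> Q i x})"
    using assms by (intro measure_UNION_le sets.sets_Collect_neg) auto
  also have "\<dots> \<le> real (card I) * b"
    using le by (rule sum_bounded_above)
  finally show ?thesis by simp
qed

lemma tendsto_prob_Int_1:
  assumes M: "\<And>n. prob_space (M n)"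
    and events: "\<And>n. A n \<in> sets (M n)" "\<And>n. B n \<in> sets (M n)"
    and lim: "((\<lambda>n. measure (M n) (A n)) \<longlongrightarrow> 1) F" "((\<lambda>n. measure (M n) (B n)) \<longlongrightarrow> 1) F"
  shows "((\<lambda>n. measure (M n) (A n \<inter> B n)) \<longlongrightarrow> 1) F"
proof (rule tendsto_sandwich[where h = "\<lambda>_. 1"])
  have "measure (M n) (A n) + measure (M n) (B n) - 1 \<le> measure (M n) (A n \<inter> B n)" for n
  proof -
    interpret prob_space "M n" by (rule M)
    have "prob (A n \<union> B n) = prob (A n) + prob (B n) - prob (A n \<inter> B n)"
      using events by (intro measure_Un3) (simp_all add: fmeasurable_eq_sets)
    then show ?thesis using prob_le_1[of "A n \<union> B n"] by simp
  qed
  then show "\<forall>\<^sub>F n in F.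
      measure (M n) (A n) + measure (M n) (B n) - 1 \<le> measure (M n) (A n \<inter> B n)"
    by simp
  show "((\<lambda>n. measure (M n) (A n) + measure (M n) (B n) - 1) \<longlongrightarrow> 1) F"
    using tendsto_diff[OF tendsto_add[OF lim] tendsto_const[of 1]] by simp
qed (simp_all add: prob_space.prob_le_1[OF M])

section \<open>Stochastic Kronecker graphs\<close>

definition expected_degree ::
  "(bit \<Rightarrow> bit \<Rightarrow> real) \<Rightarrow> bit list \<Rightarrow> bit list set \<Rightarrow> real" where
  "expected_degree P u W = (\<Sum>w\<in>W \<inter> kron_vertices (length u) - {u}. kron_prob P u w)"

lemma kron_vertices_Suc:
  "kron_vertices (Suc n) = (#) a ` kron_vertices n \<union> (#) (a + 1) ` kron_vertices n"
proof (intro set_eqI)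
  fix w
  show "w \<in> kron_vertices (Suc n)
      \<longleftrightarrow> w \<in> (#) a ` kron_vertices n \<union> (#) (a + 1) ` kron_vertices n"
    by (cases w; cases "hd w"; cases a) (auto simp: kron_vertices_def)
qed

lemma finite_kron_vertices: "finite (kron_vertices n)"
proof (induction n)
  case 0
  then show ?case by (simp add: kron_vertices_def)
next
  case (Suc n)
  then show ?case by (simp add: kron_vertices_Suc[of n 0])
qed

lemma sum_kron_vertices_Suc:
  "(\<Sum>w\<in>kron_vertices (Suc n). f w) =
     (\<Sum>w\<in>kron_vertices n. f (a # w)) + (\<Sum>w\<in>kron_vertices n. f ((a + 1) # w))"
proof -
  have "(\<Sum>w\<in>kron_vertices (Suc n). f w) =
      sum f ((#) a ` kron_vertices n) + sum f ((#) (a + 1) ` kron_vertices n)"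
    unfolding kron_vertices_Suc[of n a]
    by (rule sum.union_disjoint) (auto simp: finite_kron_vertices)
  then show ?thesis by (simp add: sum.reindex)
qed

lemma card_kron_vertices: "card (kron_vertices n) = 2 ^ n"
proof (induction n)
  case 0
  then show ?case by (simp add: kron_vertices_def)
next
  case (Suc n)
  have "card (kron_vertices (Suc n)) = (\<Sum>w\<in>kron_vertices (Suc n). 1)" by simp
  also have "\<dots> = 2 ^ Suc n"
    unfolding sum_kron_vertices_Suc[of _ n 0] using Suc by simp
  finally show ?case .
qed

lemma finite_kron_pairs: "finite (kron_pairs n)"
  by (rule finite_subset[of _ "Pow (kron_vertices n)"])
     (auto simp: kron_pairs_def finite_kron_vertices)

lemma kron_prob_nonneg:
  assumes "\<And>a b. 0 \<le> P a b"
  shows "0 \<le> kron_prob P u v"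
  using assms by (simp add: kron_prob_def prod_nonneg)

lemma kron_prob_le_1:
  assumes "\<And>a b. 0 \<le> P a b \<and> P a b \<le> 1"
  shows "kron_prob P u v \<le> 1"
  using assms by (simp add: kron_prob_def prod_le_1)

lemma kronecker_degree_Chernoff:
  assumes sym: "\<And>a b. P a b = P b a" and P: "\<And>a b. 0 \<le> P a b \<and> P a b \<le> 1"
    and u: "u \<in> kron_vertices n"
    and m: "expected_degree P u W \<le> m" and t: "0 \<le> t" "t \<le> 2"
  shows "measure_pmf.prob (kronecker_graph n P)
           {E. t * m \<le> \<bar>real (card (neighborhood E u \<inter> W)) - expected_degree P u W\<bar>}
         \<le> 2 * exp (- m * t\<^sup>2 / 4)"
proof -
  define V where "V = W \<inter> kron_vertices n - {u}"
  define F where "F = (\<lambda>w. {u, w}) ` V"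
  have inj: "inj_on (\<lambda>w. {u, w}) S" for S
    by (auto simp: inj_on_def doubleton_eq_iff)
  have "F \<subseteq> kron_pairs n"
    using u by (fastforce simp: F_def V_def kron_pairs_def)
  have edge_prob: "kron_edge_prob P {u, w} = kron_prob P u w" if "w \<in> V" for w
    using that u by (intro kron_edge_prob_doubleton sym) (simp add: V_def kron_vertices_def)
  have mean: "sum (kron_edge_prob P) F = expected_degree P u W"
  proof -
    have "sum (kron_edge_prob P) F = (\<Sum>w\<in>V. kron_prob P u w)"
      by (simp add: F_def sum.reindex[OF inj] edge_prob)
    then show ?thesis
      using u by (simp add: expected_degree_def V_def kron_vertices_def)
  qed
  have degree: "card (neighborhood {e \<in> kron_pairs n. f e} u \<inter> W) = card {e \<in> F. f e}" for f
  proof -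
    have "neighborhood {e \<in> kron_pairs n. f e} u \<inter> W = {w \<in> V. f {u, w}}"
      using u by (auto simp: neighborhood_def kron_pairs_def V_def doubleton_eq_iff)
    moreover have "{e \<in> F. f e} = (\<lambda>w. {u, w}) ` {w \<in> V. f {u, w}}"
      by (auto simp: F_def)
    ultimately show ?thesis by (simp add: card_image[OF inj])
  qed
  have "0 \<le> kron_prob P u w \<and> kron_prob P u w \<le> 1" for w
    using P by (simp add: kron_prob_nonneg kron_prob_le_1)
  then have "0 \<le> kron_edge_prob P e \<and> kron_edge_prob P e \<le> 1" if "e \<in> F" for e
    using that by (auto simp: F_def edge_prob)
  then show ?thesis
    using Pi_pmf_bernoulli_Chernoff[OF finite_kron_pairs \<open>F \<subseteq> kron_pairs n\<close>,
        where p = "kron_edge_prob P" and m = m and t = t] m t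
    by (simp add: kronecker_graph_def mean degree vimage_def)
qed

lemma kronecker_degrees_concentrated:
  fixes s :: real and \<eta> :: "nat \<Rightarrow> real"
  assumes sym: "\<And>a b. P a b = P b a" and P: "\<And>a b. 0 \<le> P a b \<and> P a b \<le> 1" and s: "1 < s"
    and upper: "\<And>n u. u \<in> kron_vertices n \<Longrightarrow> expected_degree P u (W n u) \<le> s ^ n"
    and lower: "\<And>n u. 0 < n \<Longrightarrow> u \<in> kron_vertices n \<Longrightarrow>
      (1 - \<eta> n) * s ^ n \<le> expected_degree P u (W n u)"
  shows "(\<lambda>n. measure_pmf.prob (kronecker_graph n P)
      {E. \<forall>u\<in>kron_vertices n.
        \<bar>real (card (neighborhood E u \<inter> W n u)) - s ^ n\<bar> \<le> (1 / real n + \<eta> n) * s ^ n}) \<longlonglongrightarrow> 1"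
    (is "(\<lambda>n. measure_pmf.prob _ {E. \<forall>u\<in>_. ?close n u E}) \<longlonglongrightarrow> 1")
proof (rule tendsto_sandwich[where h = "\<lambda>_. 1"])
  have vertex: "measure_pmf.prob (kronecker_graph n P) {E. \<not> ?close n u E}
      \<le> 2 * exp (- (s ^ n) * (1 / real n)\<^sup>2 / 4)" if "0 < n" "u \<in> kron_vertices n" for n u
  proof -
    have "{E. \<not> ?close n u E} \<subseteq> {E. 1 / real n * s ^ n
        \<le> \<bar>real (card (neighborhood E u \<inter> W n u)) - expected_degree P u (W n u)\<bar>}"
      using lower[OF that] upper[OF that(2)] s by (auto simp: algebra_simps)
    then have "measure_pmf.prob (kronecker_graph n P) {E. \<not> ?close n u E}
        \<le> measure_pmf.prob (kronecker_graph n P) {E. 1 / real n * s ^ n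
        \<le> \<bar>real (card (neighborhood E u \<inter> W n u)) - expected_degree P u (W n u)\<bar>}"
      by (intro measure_pmf.finite_measure_mono) auto
    also have "\<dots> \<le> 2 * exp (- (s ^ n) * (1 / real n)\<^sup>2 / 4)"
      using that by (intro kronecker_degree_Chernoff sym P upper) (auto simp: divide_le_eq)
    finally show ?thesis .
  qed
  show "\<forall>\<^sub>F n in sequentially. 1 - 2 ^ n * (2 * exp (- (s ^ n) * (1 / real n)\<^sup>2 / 4))
      \<le> measure_pmf.prob (kronecker_graph n P) {E. \<forall>u\<in>kron_vertices n. ?close n u E}"
    using eventually_gt_at_top[of 0]
  proof eventually_elim
    case (elim n)
    show ?case
      using measure_pmf.prob_Ball_ge[OF finite_kron_vertices[of n], where Q = "?close n"]
        vertex[OF elim]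
      by (simp add: card_kron_vertices)
  qed
  show "(\<lambda>n. 1 - 2 ^ n * (2 * exp (- (s ^ n) * (1 / real n)\<^sup>2 / 4))) \<longlonglongrightarrow> 1"
    using s by real_asymp
qed auto

section \<open>Expected degrees for equal diagonal entries\<close>

definition hamming_band :: "'a list \<Rightarrow> real \<Rightarrow> real \<Rightarrow> 'a list set" where
  "hamming_band u c r = {w. \<bar>real (hamming u w) - c\<bar> \<le> r}"

lemma kron_matrix_eq_diagonal: "kron_matrix \<alpha> \<beta> \<alpha> a b = (if a = b then \<alpha> else \<beta>)"
  by (cases a; cases b) (simp_all add: kron_matrix_def)

lemma kron_prob_Cons: "kron_prob P (a # u) (b # w) = P a b * kron_prob P u w"
  unfolding kron_prob_def by (simp add: prod.lessThan_Suc_shift del: prod.lessThan_Suc)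

lemma hamming_Cons: "hamming (a # u) (b # w) = of_bool (a \<noteq> b) + hamming u w"
proof -
  have "{k. k < length (a # u) \<and> (a # u) ! k \<noteq> (b # w) ! k} =
      (if a \<noteq> b then {0} else {}) \<union> Suc ` {k. k < length u \<and> u ! k \<noteq> w ! k}"
    by (auto simp: less_Suc_eq_0_disj)
  then show ?thesis
    unfolding hamming_def by (simp add: card_image)
qed

lemma expectation_binomial_pmf_Suc:
  fixes f :: "nat \<Rightarrow> real"
  assumes "q \<in> {0..1}"
  shows "measure_pmf.expectation (binomial_pmf (Suc n) q) f =
    q * measure_pmf.expectation (binomial_pmf n q) (\<lambda>k. f (Suc k)) +
    (1 - q) * measure_pmf.expectation (binomial_pmf n q) f"
proof -
  have "binomial_pmf (Suc n) q =
      bernoulli_pmf q \<bind> (\<lambda>b. map_pmf (\<lambda>k. (if b then 1 else 0) + k) (binomial_pmf n q))"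
    by (simp add: binomial_pmf_Suc[OF assms] map_pmf_def)
  also have "measure_pmf.expectation \<dots> f =
      (\<Sum>b\<in>UNIV. pmf (bernoulli_pmf q) b *\<^sub>R
        measure_pmf.expectation (map_pmf (\<lambda>k. (if b then 1 else 0) + k) (binomial_pmf n q)) f)"
    using assms by (intro pmf_expectation_bind) (auto simp: set_pmf_binomial_eq)
  finally show ?thesis
    using assms by (simp add: UNIV_bool)
qed

context
  fixes \<alpha> \<beta> :: real
  assumes nonneg: "0 \<le> \<alpha>" "0 \<le> \<beta>" and pos: "0 < \<alpha> + \<beta>"
begin

lemma kron_prob_eq_diagonal_nonneg: "0 \<le> kron_prob (kron_matrix \<alpha> \<beta> \<alpha>) u w"
  using nonneg by (intro kron_prob_nonneg) (simp add: kron_matrix_eq_diagonal)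

lemma sum_kron_prob_hamming:
  fixes f :: "nat \<Rightarrow> real"
  assumes "u \<in> kron_vertices n"
  shows "(\<Sum>w\<in>kron_vertices n. kron_prob (kron_matrix \<alpha> \<beta> \<alpha>) u w * f (hamming u w)) =
    (\<alpha> + \<beta>) ^ n * measure_pmf.expectation (binomial_pmf n (\<beta> / (\<alpha> + \<beta>))) f"
  using assms
proof (induction n arbitrary: u f)
  case 0
  then show ?case
    using nonneg pos by (simp add: kron_vertices_def kron_prob_def hamming_def binomial_pmf_0)
next
  case (Suc n)
  define s where "s = \<alpha> + \<beta>"
  define q where "q = \<beta> / s"
  have q: "q \<in> {0..1}" using nonneg pos by (simp add: q_def s_def)
  have weights: "\<alpha> = s * (1 - q)" "\<beta> = s * q"
    using pos by (simp_all add: q_def s_def field_simps)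
  obtain a v where u: "u = a # v" and v: "v \<in> kron_vertices n"
    using Suc.prems by (cases u) (auto simp: kron_vertices_def)
  let ?k = "kron_prob (kron_matrix \<alpha> \<beta> \<alpha>)"
  have "(\<Sum>w\<in>kron_vertices (Suc n). ?k u w * f (hamming u w)) =
      \<alpha> * (\<Sum>w\<in>kron_vertices n. ?k v w * f (hamming v w)) +
      \<beta> * (\<Sum>w\<in>kron_vertices n. ?k v w * f (Suc (hamming v w)))"
    by (simp add: u sum_kron_vertices_Suc[of _ n a] kron_prob_Cons hamming_Cons
        kron_matrix_eq_diagonal sum_distrib_left mult.assoc)
  also have "\<dots> = \<alpha> * (s ^ n * measure_pmf.expectation (binomial_pmf n q) f) +
      \<beta> * (s ^ n * measure_pmf.expectation (binomial_pmf n q) (\<lambda>k. f (Suc k)))"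
    by (simp only: Suc.IH[OF v, of f] Suc.IH[OF v, of "\<lambda>k. f (Suc k)"] q_def s_def)
  also have "\<dots> = s ^ Suc n * measure_pmf.expectation (binomial_pmf (Suc n) q) f"
    unfolding expectation_binomial_pmf_Suc[OF q] weights by (simp add: algebra_simps)
  finally show ?case by (simp only: q_def s_def)
qed

lemma sum_kron_prob:
  assumes "u \<in> kron_vertices n"
  shows "(\<Sum>w\<in>kron_vertices n. kron_prob (kron_matrix \<alpha> \<beta> \<alpha>) u w) = (\<alpha> + \<beta>) ^ n"
  using sum_kron_prob_hamming[OF assms, of "\<lambda>_. 1"] by simp

lemma sum_kron_prob_outside_hamming_band_le:
  assumes "u \<in> kron_vertices n" "0 < n" "0 \<le> r"
  shows "(\<Sum>w\<in>kron_vertices n - hamming_band u (\<beta> / (\<alpha> + \<beta>) * real n) r.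
            kron_prob (kron_matrix \<alpha> \<beta> \<alpha>) u w)
    \<le> 2 * exp (- 2 * r\<^sup>2 / real n) * (\<alpha> + \<beta>) ^ n"
proof -
  define q where "q = \<beta> / (\<alpha> + \<beta>)"
  let ?far = "{k. r < \<bar>real k - q * real n\<bar>}"
  interpret binomial_distribution n q
    using nonneg pos by unfold_locales (simp add: q_def)
  have "(\<Sum>w\<in>kron_vertices n - hamming_band u (q * real n) r. kron_prob (kron_matrix \<alpha> \<beta> \<alpha>) u w)
      = (\<Sum>w\<in>kron_vertices n. kron_prob (kron_matrix \<alpha> \<beta> \<alpha>) u w * indicator ?far (hamming u w))"
    by (intro sum.mono_neutral_cong_left) (auto simp: finite_kron_vertices hamming_band_def)
  also have "\<dots> = (\<alpha> + \<beta>) ^ n * measure_pmf.prob (binomial_pmf n q) ?far"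
    using sum_kron_prob_hamming[OF assms(1), of "indicator ?far"] by (simp add: q_def)
  also have "\<dots> \<le> (\<alpha> + \<beta>) ^ n * measure_pmf.prob (binomial_pmf n q) {k. r \<le> \<bar>real k - real n * q\<bar>}"
    using pos
    by (intro mult_left_mono measure_pmf.finite_measure_mono) (auto simp: mult.commute)
  also have "\<dots> \<le> (\<alpha> + \<beta>) ^ n * (2 * exp (- 2 * r\<^sup>2 / real n))"
    using assms pos by (intro mult_left_mono prob_abs_ge) auto
  finally show ?thesis by (simp add: q_def mult_ac)
qed

lemma
  assumes "u \<in> kron_vertices n"
  shows expected_degree_le: "expected_degree (kron_matrix \<alpha> \<beta> \<alpha>) u W \<le> (\<alpha> + \<beta>) ^ n"
    and expected_degree_ge: "(\<alpha> + \<beta>) ^ n - \<alpha> ^ n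
        - (\<Sum>w\<in>kron_vertices n - W. kron_prob (kron_matrix \<alpha> \<beta> \<alpha>) u w)
      \<le> expected_degree (kron_matrix \<alpha> \<beta> \<alpha>) u W"
proof -
  let ?k = "kron_prob (kron_matrix \<alpha> \<beta> \<alpha>) u"
  define T where "T = W \<inter> kron_vertices n - {u}"
  have len: "length u = n" using assms by (simp add: kron_vertices_def)
  have degree: "expected_degree (kron_matrix \<alpha> \<beta> \<alpha>) u W = sum ?k T"
    by (simp add: expected_degree_def T_def len)
  have "?k u = \<alpha> ^ n"
    by (simp add: kron_prob_def kron_matrix_eq_diagonal len)
  have total: "sum ?k (kron_vertices n - T) + sum ?k T = (\<alpha> + \<beta>) ^ n"
    by (subst sum.subset_diff[symmetric])
       (auto simp: T_def finite_kron_vertices sum_kron_prob[OF assms])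
  have "0 \<le> sum ?k (kron_vertices n - T)" by (intro sum_nonneg kron_prob_eq_diagonal_nonneg)
  then show "expected_degree (kron_matrix \<alpha> \<beta> \<alpha>) u W \<le> (\<alpha> + \<beta>) ^ n"
    using total degree by simp
  have "kron_vertices n - T = insert u (kron_vertices n - W)"
    using assms by (auto simp: T_def)
  then have "sum ?k (kron_vertices n - T) \<le> ?k u + sum ?k (kron_vertices n - W)"
    using kron_prob_eq_diagonal_nonneg[of u u] by (simp add: sum.insert_if finite_kron_vertices)
  then show "(\<alpha> + \<beta>) ^ n - \<alpha> ^ n - sum ?k (kron_vertices n - W)
      \<le> expected_degree (kron_matrix \<alpha> \<beta> \<alpha>) u W"
    using total degree \<open>?k u = \<alpha> ^ n\<close> by simp
qed

lemma expected_degree_ge_of_hamming_band_subset: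
  assumes "u \<in> kron_vertices n" "0 < n" "0 \<le> r"
    and "hamming_band u (\<beta> / (\<alpha> + \<beta>) * real n) r \<subseteq> W"
  shows "(1 - ((\<alpha> / (\<alpha> + \<beta>)) ^ n + 2 * exp (- 2 * r\<^sup>2 / real n))) * (\<alpha> + \<beta>) ^ n
    \<le> expected_degree (kron_matrix \<alpha> \<beta> \<alpha>) u W"
proof -
  let ?k = "kron_prob (kron_matrix \<alpha> \<beta> \<alpha>) u"
  have "sum ?k (kron_vertices n - W)
      \<le> sum ?k (kron_vertices n - hamming_band u (\<beta> / (\<alpha> + \<beta>) * real n) r)"
    using assms(4) finite_kron_vertices kron_prob_eq_diagonal_nonneg by (intro sum_mono2) auto
  also have "\<dots> \<le> 2 * exp (- 2 * r\<^sup>2 / real n) * (\<alpha> + \<beta>) ^ n"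
    by (rule sum_kron_prob_outside_hamming_band_le[OF assms(1-3)])
  finally have "sum ?k (kron_vertices n - W) \<le> 2 * exp (- 2 * r\<^sup>2 / real n) * (\<alpha> + \<beta>) ^ n" .
  moreover have "\<alpha> ^ n = (\<alpha> / (\<alpha> + \<beta>)) ^ n * (\<alpha> + \<beta>) ^ n"
    using pos by (simp add: power_divide)
  ultimately show ?thesis
    using expected_degree_ge[OF assms(1), of W] by (simp add: algebra_simps)
qed

lemma kronecker_degrees_concentrated_of_hamming_band_subset:
  assumes le_1: "\<alpha> \<le> 1" "\<beta> \<le> 1" and gt_1: "1 < \<alpha> + \<beta>" and r: "\<And>n. 0 \<le> r n"
    and band: "\<And>n u. hamming_band u (\<beta> / (\<alpha> + \<beta>) * real n) (r n) \<subseteq> W n u"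
  shows "(\<lambda>n. measure_pmf.prob (kronecker_graph n (kron_matrix \<alpha> \<beta> \<alpha>))
      {E. \<forall>u\<in>kron_vertices n.
        \<bar>real (card (neighborhood E u \<inter> W n u)) - (\<alpha> + \<beta>) ^ n\<bar>
          \<le> (1 / real n + ((\<alpha> / (\<alpha> + \<beta>)) ^ n + 2 * exp (- 2 * (r n)\<^sup>2 / real n)))
            * (\<alpha> + \<beta>) ^ n}) \<longlonglongrightarrow> 1"
proof (rule kronecker_degrees_concentrated)
  show "0 \<le> kron_matrix \<alpha> \<beta> \<alpha> a b \<and> kron_matrix \<alpha> \<beta> \<alpha> a b \<le> 1" for a b
    using nonneg le_1 by (simp add: kron_matrix_eq_diagonal)
  show "(1 - ((\<alpha> / (\<alpha> + \<beta>)) ^ n + 2 * exp (- 2 * (r n)\<^sup>2 / real n))) * (\<alpha> + \<beta>) ^ n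
      \<le> expected_degree (kron_matrix \<alpha> \<beta> \<alpha>) u (W n u)"
    if "0 < n" "u \<in> kron_vertices n" for n u
    using that r band by (intro expected_degree_ge_of_hamming_band_subset)
qed (fact kron_matrix_sym gt_1 expected_degree_le)+

end

theorem theorem4:
  fixes \<alpha> \<beta> \<gamma> :: real
  assumes "0 < \<alpha>" "\<alpha> < 1" "0 < \<beta>" "\<beta> < 1" "0 < \<gamma>" "\<gamma> < 1"
    and "\<alpha> = \<gamma>" and "\<alpha> + \<beta> > 1"
  shows "\<exists>\<delta> \<delta>' \<epsilon> :: nat \<Rightarrow> real.
    \<delta> \<longlonglongrightarrow> 0 \<and> \<delta>' \<longlonglongrightarrow> 0 \<and> \<epsilon> \<longlonglongrightarrow> 0 \<and>
    (\<lambda>n. measure_pmf.prob (kronecker_graph n (kron_matrix \<alpha> \<beta> \<gamma>))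
       {E. \<forall>u \<in> kron_vertices n.
          \<bar>real (card (neighborhood E u)) - (\<alpha> + \<beta>) ^ n\<bar> \<le> \<delta> n * (\<alpha> + \<beta>) ^ n \<and>
          \<bar>real (card {w \<in> neighborhood E u.
                \<bar>real (hamming u w) - \<beta> / (\<alpha> + \<beta>) * real n\<bar> \<le> \<epsilon> n * real n})
             - (\<alpha> + \<beta>) ^ n\<bar> \<le> \<delta>' n * (\<alpha> + \<beta>) ^ n})
      \<longlonglongrightarrow> 1"
proof -
  define \<epsilon> where "\<epsilon> n = real n powr (- 1 / 4)" for n
  define \<rho> where "\<rho> = \<alpha> / (\<alpha> + \<beta>)"
  define \<delta> where
    "\<delta> n = 1 / real n + (\<rho> ^ n + 2 * exp (- 2 * (\<epsilon> n * real n)\<^sup>2 / real n))" for n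
  define band where "band n u = hamming_band u (\<beta> / (\<alpha> + \<beta>) * real n) (\<epsilon> n * real n)"
    for n and u :: "bit list"
  have concentrated: "(\<lambda>n. measure_pmf.prob (kronecker_graph n (kron_matrix \<alpha> \<beta> \<gamma>))
      {E. \<forall>u\<in>kron_vertices n. \<bar>real (card (neighborhood E u \<inter> W n u)) - (\<alpha> + \<beta>) ^ n\<bar>
        \<le> \<delta> n * (\<alpha> + \<beta>) ^ n}) \<longlonglongrightarrow> 1"
    if "\<And>n u. band n u \<subseteq> W n u" for W
    unfolding \<delta>_def \<rho>_def \<open>\<alpha> = \<gamma>\<close>[symmetric]
    using assms that[unfolded band_def]
    by (intro kronecker_degrees_concentrated_of_hamming_band_subset) (auto simp: \<epsilon>_def)
  have "0 < \<rho>" "\<rho> < 1" using assms by (simp_all add: \<rho>_def)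
  then have "\<delta> \<longlonglongrightarrow> 0" unfolding \<delta>_def \<epsilon>_def by real_asymp
  moreover have "\<epsilon> \<longlonglongrightarrow> 0" unfolding \<epsilon>_def by real_asymp
  moreover have "neighborhood E u \<inter> band n u = {w \<in> neighborhood E u.
      \<bar>real (hamming u w) - \<beta> / (\<alpha> + \<beta>) * real n\<bar> \<le> \<epsilon> n * real n}" for E u n
    by (auto simp: band_def hamming_band_def)
  ultimately show ?thesis
    using tendsto_prob_Int_1[OF measure_pmf.prob_space_axioms _ _
        concentrated[of "\<lambda>_ _. UNIV"] concentrated[of band]]
    by (intro exI[of _ \<delta>] exI[of _ \<epsilon>] conjI)
       (simp_all add: ball_conj_distrib flip: Collect_conj_eq)
qed

end
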